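(* For every $n\geq 4$, \[ 2C(n-2)+C(n-3)\leq \lvert\operatorname{Arith}(D_n)\rvert < 2C(n-2)+702\,C(n-3), \] where $C(j)=\frac{1}{j+1}\binom{2j}{j}$ is the $j$-th Catalan number.
   Context: For $n\ge 3$ let $\ell=n-3$. The bident $D_n$ is the graph with vertices $v_x,v_y,v_0,v_1,\dots,v_\ell$ and edges $v_xv_0$, $v_yv_0$, and $v_iv_{i+1}$ for $0\le i\le \ell-1$. For a finite connected graph $G$ with adjacency matrix $A$, an arithmetical structure on $G$ is a pair $(\mathbf d,\mathbf r)$ of vectors with positive integer entries indexed by the vertices such that $(\operatorname{diag}(\mathbf d)-A)\mathbf r=\mathbf 0$ and the entries of $\mathbf r$ have no nontrivial common factor. $\operatorname{Arith}(D_n)$ is the set of arithmetical structures on $D_n$. *)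

theory Defs
  imports Complex_Main "HOL-Library.FuncSet"
begin

text \<open>A simple graph is given by a vertex set \<open>V\<close> and a set \<open>E\<close> of
  two-element sets of vertices; matrices indexed by vertices are functions of two vertices.\<close>

definition adj_matrix :: "'a set set \<Rightarrow> 'a \<Rightarrow> 'a \<Rightarrow> int" where
  "adj_matrix E u v = (if {u, v} \<in> E then 1 else 0)"

definition diag_matrix :: "('a \<Rightarrow> int) \<Rightarrow> 'a \<Rightarrow> 'a \<Rightarrow> int" where
  "diag_matrix d u v = (if u = v then d u else 0)"

text \<open>Vectors indexed by \<open>V\<close> are functions in \<open>V \<rightarrow>\<^sub>E {0<..}\<close>, i.e.\ positive on \<open>V\<close>
  and \<open>undefined\<close> elsewhere, so that each vector is represented by exactly one function
  and structures are counted without repetition.\<close>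

definition Arith :: "'a set \<Rightarrow> 'a set set \<Rightarrow> (('a \<Rightarrow> int) \<times> ('a \<Rightarrow> int)) set" where
  "Arith V E = {(d, r).
     d \<in> V \<rightarrow>\<^sub>E {0<..} \<and> r \<in> V \<rightarrow>\<^sub>E {0<..} \<and>
     (\<forall>u\<in>V. (\<Sum>v\<in>V. (diag_matrix d u v - adj_matrix E u v) * r v) = 0) \<and>
     Gcd (r ` V) = 1}"

datatype bident_vertex = Vx | Vy | Vpath nat

definition bident_verts :: "nat \<Rightarrow> bident_vertex set" where
  "bident_verts n = {Vx, Vy} \<union> Vpath ` {0..n - 3}"

definition bident_edges :: "nat \<Rightarrow> bident_vertex set set" where
  "bident_edges n =
     {{Vx, Vpath 0}, {Vy, Vpath 0}} \<union> {{Vpath i, Vpath (i + 1)} | i. i < n - 3}"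

definition catalan :: "nat \<Rightarrow> real" where
  "catalan j = 1 / (real j + 1) * real ((2 * j) choose j)"

end

theory Submission
  imports Defs
begin

text \<open>
  Put \<open>l = n - 3\<close>, let \<open>p\<close>, \<open>q\<close>, \<open>D\<close> be the entries of \<open>d\<close> at \<open>v\<^sub>x\<close>, \<open>v\<^sub>y\<close>, \<open>v\<^sub>0\<close> and let
  \<open>d\<^sub>1, \<dots>, d\<^sub>l\<close> be those on the path. Then \<open>d\<close> determines \<open>r\<close>, and \<open>d\<close> occurs iff
  \<open>D - 1/p - 1/q = 1/[d\<^sub>1, \<dots>, d\<^sub>l]\<close> for the negative continued fraction
  \<open>[d\<^sub>1, \<dots>, d\<^sub>l] = d\<^sub>1 - 1/(d\<^sub>2 - \<dots>)\<close>, all of whose tails have to be positive.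

  For a fixed rational \<open>t\<close> the number of solutions \<open>(D, d\<^sub>1, \<dots>, d\<^sub>l)\<close> of
  \<open>D + t = 1/[d\<^sub>1, \<dots>, d\<^sub>l]\<close> depends only on the length \<open>m\<close> of the reduced expansion (all
  \<open>d\<^sub>i \<ge> 2\<close>) of the inverse of the fractional part of \<open>t\<close>: splitting off \<open>D\<close>, the possible
  \<open>D\<close> lead to reduced lengths \<open>m - 1, m, m + 1, \<dots>\<close> once each (\<open>0, 1, \<dots>\<close> if \<open>m = 0\<close>), which is the recurrence of the
  ballot numbers. Hence the count is the sum of the ballot numbers with parameters \<open>l\<close> and
  \<open>m(p, q)\<close> over all \<open>p, q \<ge> 1\<close>. The pairs with \<open>p = 1\<close> or \<open>q = 1\<close> contribute
  \<open>2 C(l + 1) - C(l)\<close>, and each of \<open>(2, 2)\<close> and \<open>(2, 3)\<close> contributes \<open>C(l)\<close>. For the upper bound,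
  the number of \<open>p, q \<ge> 2\<close> with \<open>m(p, q) \<le> m\<close> is at most a quartic polynomial in \<open>m\<close>, whereas the ballot number is at
  most \<open>C(l) (m + 1) / 2\<^sup>m\<close>; summation by parts yields at most \<open>608 C(l)\<close>.
\<close>

subsection \<open>Ballot numbers\<close>

text \<open>The truncated \<open>m - 1\<close> is deliberate: a reduced length of 0 and a reduced
  length of 1 allow the same lengths 0, 1, ... after one step.\<close>

fun ballot :: "nat \<Rightarrow> nat \<Rightarrow> nat" where
  "ballot 0 m = (if m = 0 then 1 else 0)"
| "ballot (Suc l) m = (\<Sum>j=m-1..l. ballot l j)"

lemma ballot_eq_0: "l < m \<Longrightarrow> ballot l m = 0"
  by (cases l) auto

lemma ballot_Suc_0_eq_1: "ballot (Suc l) 0 = ballot (Suc l) 1"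
  by simp

lemma ballot_diff: "m \<le> l \<Longrightarrow> ballot (Suc l) (Suc m) = ballot (Suc l) (Suc (Suc m)) + ballot l m"
  by (simp add: sum.atLeast_Suc_atMost)

text \<open>Pascal's rule combined with absorption. It makes the closed form obey the recurrence
  \<open>ballot_diff\<close>, and at \<open>m = 0\<close> the last term vanishes, so columns 0 and 1
  agree as they do for \<open>ballot\<close>.\<close>

lemma ballot_closed_step:
  assumes "m \<le> Suc l"
  shows "(real m + 1) / (real l + 2) * real ((2 * Suc l - m) choose Suc l) =
         (real m + 2) / (real l + 2) * real ((2 * Suc l - Suc m) choose Suc l) +
         real m / (real l + 1) * real ((2 * l + 1 - m) choose l)"
proof -
  define N where "N = 2 * l + 1 - m"
  have N: "2 * Suc l - m = Suc N" "2 * Suc l - Suc m = N" "l \<le> N"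
    using assms by (auto simp: N_def)
  have "(N - l) * (N choose l) = Suc l * (N choose Suc l)"
    using binomial_absorb_comp[of N l] binomial_absorption[of l N]
    by (metis binomial_absorb_comp binomial_absorption diff_Suc_1)
  then have "real (N - l) * real (N choose l) = real (Suc l) * real (N choose Suc l)"
    by (metis of_nat_mult)
  moreover have "real (N - l) = real l + 1 - real m"
    using assms by (simp add: N_def of_nat_diff)
  ultimately have *: "real (N choose Suc l) = (real l + 1 - real m) * real (N choose l) / (real l + 1)"
    by (simp add: field_simps)
  show ?thesis
    unfolding N N_def[symmetric] binomial_Suc_Suc of_nat_add *
    by (simp add: divide_simps) (simp add: algebra_simps)
qed

lemma ballot_closed:
  "m \<le> l \<Longrightarrow> real (ballot l m) = (real m + 1) / (real l + 1) * real ((2 * l - m) choose l)"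
proof (induction l arbitrary: m)
  case 0
  then show ?case by simp
next
  case (Suc l)
  let ?w = "\<lambda>m. (real m + 1) / (real l + 2) * real ((2 * Suc l - m) choose Suc l)"
  \<comment> \<open>Downward induction on the column, starting beyond the diagonal, where both sides
    are 0.\<close>
  have pos: "real (ballot (Suc l) (Suc m)) = ?w (Suc m)" if "m \<le> Suc l" for m
    using that
  proof (induction m rule: inc_induct)
    case base
    then show ?case by (simp add: ballot_eq_0)
  next
    case (step m)
    have "real (ballot (Suc l) (Suc m)) = ?w (Suc (Suc m)) + real (ballot l m)"
      using step ballot_diff[of m l] by simp
    also have "real (ballot l m) = (real m + 1) / (real l + 1) * real ((2 * l - m) choose l)"
      using step Suc.IH by simp
    also have "?w (Suc (Suc m)) + \<dots> = ?w (Suc m)"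
      using ballot_closed_step[of "Suc m" l] step by (simp add: add_ac)
    finally show ?case .
  qed
  show ?case
  proof (cases m)
    case 0
    then have "real (ballot (Suc l) m) = ?w 1"
      using pos[of 0] ballot_Suc_0_eq_1[of l] by simp
    also have "\<dots> = ?w 0"
      using ballot_closed_step[of 0 l] by simp
    finally show ?thesis using 0 by (simp add: add_ac)
  next
    case (Suc k)
    then show ?thesis using pos[of k] Suc.prems by (simp add: add_ac)
  qed
qed

lemma ballot_0_catalan: "real (ballot l 0) = catalan l"
  by (simp add: ballot_closed catalan_def)

text \<open>Lowering the upper index from N to N - 1 multiplies the binomial by (N - l)/N, which is
  at most 1/2 because N is at most 2l.\<close>

lemma binomial_halving: "m \<le> l \<Longrightarrow> 2 ^ m * ((2 * l - m) choose l) \<le> (2 * l) choose l"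
proof (induction m)
  case 0
  then show ?case by simp
next
  case (Suc m)
  define N where "N = 2 * l - m"
  have N: "2 * l - Suc m = N - 1" "N > 0" "2 * (N - l) \<le> N"
    using Suc.prems by (auto simp: N_def)
  have "N * (2 * ((N - 1) choose l)) = 2 * (N - l) * (N choose l)"
    using binomial_absorb_comp[of N l] by simp
  also have "\<dots> \<le> N * (N choose l)"
    using N by (intro mult_right_mono) auto
  finally have "2 * ((N - 1) choose l) \<le> N choose l"
    using N by simp
  then have "2 ^ m * (2 * ((N - 1) choose l)) \<le> 2 ^ m * (N choose l)"
    by simp
  also have "\<dots> \<le> (2 * l) choose l"
    using Suc by (simp add: N_def)
  finally show ?case
    unfolding N by (simp only: power_Suc mult_ac)
qed

lemma ballot_le_catalan: "real (ballot l m) \<le> catalan l * ((real m + 1) / 2 ^ m)"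
proof (cases "m \<le> l")
  case True
  have "real (2 ^ m * ((2 * l - m) choose l)) \<le> real ((2 * l) choose l)"
    using binomial_halving[OF True] of_nat_le_iff by blast
  then have "real ((2 * l - m) choose l) \<le> real ((2 * l) choose l) / 2 ^ m"
    by (simp add: field_simps)
  then have "(real m + 1) / (real l + 1) * real ((2 * l - m) choose l) \<le>
             (real m + 1) / (real l + 1) * (real ((2 * l) choose l) / 2 ^ m)"
    by (intro mult_left_mono) auto
  then show ?thesis
    by (simp add: ballot_closed[OF True] catalan_def mult_ac)
next
  case False
  then show ?thesis by (simp add: ballot_eq_0 catalan_def)
qed

subsection \<open>Reduced continued fractions\<close>

text \<open>The length of the reduced expansion \<open>a / (b mod a) = d\<^sub>1 - 1 / (d\<^sub>2 - \<dots>)\<close> with all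
  \<open>d\<^sub>i \<ge> 2\<close>; it is \<open>0\<close> if \<open>a\<close> divides \<open>b\<close>.\<close>

function hj_length :: "int \<Rightarrow> int \<Rightarrow> nat" where
  "hj_length a b = (if a \<le> 0 \<or> b mod a = 0 then 0 else Suc (hj_length (b mod a) (- a)))"
  by pat_completeness auto
termination
  by (relation "measure (\<lambda>(a, b). nat a)") auto

declare hj_length.simps [simp del]

lemma hj_length_mod_cong: "b mod a = c mod a \<Longrightarrow> hj_length a b = hj_length a c"
  by (subst (1 2) hj_length.simps) simp

lemma hj_length_minus_add: "hj_length a (- (a + b)) = hj_length a (- b)"
  by (rule hj_length_mod_cong) (simp add: mod_eq_dvd_iff)

lemma hj_length_pos: "0 < a \<Longrightarrow> \<not> a dvd b \<Longrightarrow> 0 < hj_length a b"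
  by (subst hj_length.simps) (auto simp: dvd_eq_mod_eq_0)

lemma hj_length_Suc: "0 < b \<Longrightarrow> b < a \<Longrightarrow> hj_length a b = Suc (hj_length b (- a))"
  by (subst hj_length.simps) simp

text \<open>With c = k a + b and k >= 1 one has (c + a)/c = 2 - (c - a)/c, so each further multiple
  of a puts one more 2 in front of the expansion. For k = 0, (a + b)/b = 1 + a/b merely raises the
  first entry.\<close>

lemma hj_length_shift:
  assumes "0 \<le> b" "b < a"
  shows "hj_length (int (Suc k) * a + b) (- a) = hj_length a b + k"
proof (induction k)
  case 0
  have m: "(- a) mod (a + b) = b"
  proof -
    have "(- a) mod (a + b) = (- a + (a + b)) mod (a + b)"
      by (rule mod_add_self2[symmetric])
    also have "\<dots> = b" using assms by simp
    finally show ?thesis .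
  qed
  show ?case
  proof (cases "b = 0")
    case True
    then show ?thesis using m by (subst (1 2) hj_length.simps) simp
  next
    case False
    have "hj_length (a + b) (- a) = Suc (hj_length b (- (a + b)))"
      using m assms False by (subst hj_length.simps) auto
    also have "hj_length b (- (a + b)) = hj_length b (- a)"
      using hj_length_minus_add[of b a] by (simp add: add.commute)
    finally show ?thesis
      using assms False by (simp add: hj_length_Suc)
  qed
next
  case (Suc k)
  let ?c = "int (Suc k) * a + b"
  have c: "0 < ?c" using assms by (simp add: add_pos_nonneg)
  have m: "(- a) mod (?c + a) = ?c"
  proof -
    have "(- a) mod (?c + a) = (- a + (?c + a)) mod (?c + a)"
      by (rule mod_add_self2[symmetric])
    also have "\<dots> = ?c" using c assms by simp
    finally show ?thesis .
  qed
  have "int (Suc (Suc k)) * a + b = ?c + a" by (simp add: algebra_simps)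
  then have "hj_length (int (Suc (Suc k)) * a + b) (- a) = hj_length (?c + a) (- a)" by (simp only:)
  also have "\<dots> = Suc (hj_length ?c (- (?c + a)))"
    using m c assms by (subst hj_length.simps) auto
  also have "hj_length ?c (- (?c + a)) = hj_length ?c (- a)"
    by (rule hj_length_minus_add)
  finally show ?case using Suc by simp
qed

text \<open>\<open>chain a b [d\<^sub>1, \<dots>, d\<^sub>l]\<close> says that \<open>r\<^sub>0 = a\<close>, \<open>r\<^sub>1 = b\<close>, \<open>r\<^sub>i\<^sub>+\<^sub>1 = d\<^sub>i r\<^sub>i - r\<^sub>i\<^sub>-\<^sub>1\<close> defines a
  sequence that is positive for \<open>1 \<le> i \<le> l\<close> and has \<open>r\<^sub>l\<^sub>+\<^sub>1 = 0\<close>.\<close>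

fun chain :: "int \<Rightarrow> int \<Rightarrow> int list \<Rightarrow> bool" where
  "chain a b [] \<longleftrightarrow> b = 0"
| "chain a b (d # ds) \<longleftrightarrow> 0 < b \<and> chain b (d * b - a) ds"

text \<open>Signs of \<open>D\<close> and \<open>ds\<close> are left free; for the data of the
  bident their positivity is a consequence, derived in \<open>read_data_surj\<close>.\<close>

definition rooted_chains :: "nat \<Rightarrow> int \<Rightarrow> int \<Rightarrow> (int \<times> int list) set" where
  "rooted_chains l a b = {(D, ds). length ds = l \<and> chain a (D * a + b) ds}"

lemma chain_scale: "0 < c \<Longrightarrow> chain (c * a) (c * b) ds = chain a b ds"
proof (induction ds arbitrary: a b)
  case (Cons d ds)
  have "d * (c * b) - c * a = c * (d * b - a)" by (simp add: algebra_simps)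
  then show ?case using Cons by (simp add: zero_less_mult_iff)
qed auto

text \<open>Once D is fixed with r1 = D a + b > 0, the list of length l + 1 is a rooted chain of
  length l for the pair (r1, -a), its first entry taking over the role of D. As D varies,
  \<open>hj_length r1 (- a)\<close> takes each value from \<open>hj_length a b - 1\<close>
  (truncated) on exactly once, which is the recursion of \<open>ballot\<close>.\<close>

lemma card_rooted_chains:
  "0 < a \<Longrightarrow> finite (rooted_chains l a b) \<and> card (rooted_chains l a b) = ballot l (hj_length a b)"
proof (induction l arbitrary: a b)
  case 0
  show ?case
  proof (cases "a dvd b")
    case True
    then obtain e where e: "b = a * e" by (rule dvdE)
    have "D * a + b = a * (D + e)" for D by (simp add: e algebra_simps)
    then have "rooted_chains 0 a b = {(- e, [])}"
      using 0 by (auto simp: rooted_chains_def)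
    moreover have "hj_length a b = 0"
      using True by (subst hj_length.simps) auto
    ultimately show ?thesis by simp
  next
    case False
    have "D * a + b \<noteq> 0" for D
    proof
      assume "D * a + b = 0"
      then have "b = a * (- D)" by (simp add: algebra_simps)
      with False show False by simp
    qed
    then have "rooted_chains 0 a b = {}" by (auto simp: rooted_chains_def)
    then show ?thesis using hj_length_pos[OF 0 False] by simp
  qed
next
  case (Suc l)
  \<comment> \<open>\<open>D j\<close> is the root entry that leaves reduced length
    \<open>j\<close>. If a divides b, then D a + b = k a needs k >= 1 rather than k >= 0, whence the
    correction by 1.\<close>
  define b' m D where "b' = b mod a" and "m = hj_length a b"
    and "D = (\<lambda>j::nat. int j - int (m - 1) - b div a + (if b' = 0 then 1 else 0))"
  have b': "0 \<le> b'" "b' < a" using Suc.prems by (auto simp: b'_def)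
  have b: "b = (b div a) * a + b'" by (simp add: b'_def)
  have m: "m = hj_length a b'"
    unfolding m_def by (rule hj_length_mod_cong) (simp add: b'_def)
  have m0: "m = 0 \<longleftrightarrow> b' = 0"
    unfolding m_def using Suc.prems by (subst hj_length.simps) (auto simp: b'_def)
  have len: "hj_length (D j * a + b) (- a) = j" if "m - 1 \<le> j" for j
  proof (cases "b' = 0")
    case True
    have "D j * a + b = int (Suc j) * a + b'"
      using True m0 by (subst b) (simp add: D_def algebra_simps)
    then show ?thesis using hj_length_shift[OF b', of j] m m0 True by simp
  next
    case False
    then obtain m' where m': "m = Suc m'" using m0 by (cases m) auto
    obtain k where k: "j = m' + k" using \<open>m - 1 \<le> j\<close> m' le_Suc_ex by auto
    have D: "D j * a + b = int k * a + b'"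
      using False by (subst b) (simp add: D_def algebra_simps m' k)
    show ?thesis
    proof (cases k)
      case 0
      have "m = Suc (hj_length b' (- a))"
        using m False b' hj_length_Suc[of b' a] by simp
      then show ?thesis using D 0 k m' by simp
    next
      case (Suc i)
      then show ?thesis using D hj_length_shift[OF b', of i] k m m' by simp
    qed
  qed
  have range: "\<exists>j\<ge>m - 1. E = D j" if "0 < E * a + b" for E
  proof -
    define k where "k = E + b div a"
    have k: "0 < k * a + b'" using that by (subst (asm) b) (simp add: k_def algebra_simps)
    have "0 \<le> k"
    proof (rule ccontr)
      assume "\<not> 0 \<le> k"
      then have "k * a \<le> (- 1) * a" using Suc.prems by (intro mult_right_mono) auto
      with k b' show False by simp
    qed
    moreover have "0 < k" if "b' = 0" using k that Suc.prems by (simp add: zero_less_mult_iff)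
    ultimately show ?thesis
      by (intro exI[of _ "nat (k + int (m - 1) - (if b' = 0 then 1 else 0))"])
        (auto simp: D_def k_def nat_diff_distrib' le_nat_iff)
  qed
  have pos: "0 < D j * a + b" if "m - 1 \<le> j" for j
  proof -
    have "D j * a + b = (D j + b div a) * a + b'"
      by (subst b) (simp add: algebra_simps)
    moreover have "0 \<le> D j + b div a" "b' = 0 \<Longrightarrow> 0 < D j + b div a"
      using that by (auto simp: D_def)
    ultimately show ?thesis using Suc.prems b'
      by (cases "b' = 0") (auto simp: zero_less_mult_iff add_nonneg_pos)
  qed
  define g where "g = (\<lambda>j. (\<lambda>(d, ds). (D j, d # ds)) ` rooted_chains l (D j * a + b) (- a))"
  have g: "finite (g j)" "card (g j) = ballot l j" if "m - 1 \<le> j" for j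
  proof -
    have *: "finite (rooted_chains l (D j * a + b) (- a))" "card (rooted_chains l (D j * a + b) (- a)) = ballot l j"
      using Suc.IH[OF pos[OF that], of "- a"] len[OF that] by auto
    show "finite (g j)" using * by (simp add: g_def)
    have "inj_on (\<lambda>(d, ds). (D j, d # ds)) (rooted_chains l (D j * a + b) (- a))"
      by (auto simp: inj_on_def)
    then show "card (g j) = ballot l j" using * by (simp add: g_def card_image)
  qed
  have "rooted_chains (Suc l) a b = (\<Union>j\<in>{m-1..l}. g j)"
  proof (intro equalityI subsetI)
    fix x assume "x \<in> rooted_chains (Suc l) a b"
    then obtain E d ds where x: "x = (E, d # ds)" "length ds = l" "0 < E * a + b"
      "chain (E * a + b) (d * (E * a + b) - a) ds"
      by (auto simp: rooted_chains_def length_Suc_conv)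
    obtain j where j: "j \<ge> m - 1" "E = D j" using range[OF x(3)] by auto
    have "x \<in> g j"
      unfolding g_def using x j by (auto simp: rooted_chains_def intro!: image_eqI[of _ _ "(d, ds)"])
    \<comment> \<open>\<open>g j\<close> is nonempty, whereas \<open>ballot l j\<close> vanishes for
      j > l.\<close>
    moreover have "j \<le> l"
      using g[OF j(1)] \<open>x \<in> g j\<close> ballot_eq_0[of l j] by (metis card_0_eq empty_iff not_le)
    ultimately show "x \<in> (\<Union>j\<in>{m-1..l}. g j)" using j by auto
  next
    fix x assume "x \<in> (\<Union>j\<in>{m-1..l}. g j)"
    then show "x \<in> rooted_chains (Suc l) a b"
      using pos by (auto simp: g_def rooted_chains_def)
  qed
  moreover have "finite (\<Union>j\<in>{m-1..l}. g j)" using g by auto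
  moreover have "card (\<Union>j\<in>{m-1..l}. g j) = (\<Sum>j=m-1..l. card (g j))"
    using g by (intro card_UN_disjoint) (auto simp: g_def D_def)
  ultimately show ?case using g by (simp add: m_def[symmetric])
qed

subsection \<open>Arithmetical structures as continued fractions\<close>

fun cseq :: "int \<Rightarrow> int \<Rightarrow> int list \<Rightarrow> nat \<Rightarrow> int" where
  "cseq a b ds 0 = a"
| "cseq a b ds (Suc 0) = b"
| "cseq a b ds (Suc (Suc i)) = ds ! i * cseq a b ds (Suc i) - cseq a b ds i"

lemma chain_iff:
  assumes "\<And>i. i < l \<Longrightarrow> \<rho> (Suc (Suc i)) = \<delta> i * \<rho> (Suc i) - \<rho> i"
  shows "chain (\<rho> 0) (\<rho> 1) (map \<delta> [0..<l]) \<longleftrightarrow> (\<forall>i<l. 0 < \<rho> (Suc i)) \<and> \<rho> (Suc l) = 0"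
  using assms
proof (induction l arbitrary: \<rho> \<delta>)
  case 0
  then show ?case by simp
next
  case (Suc l)
  have "chain (\<rho> 1) (\<rho> 2) (map (\<delta> \<circ> Suc) [0..<l]) \<longleftrightarrow>
        (\<forall>i<l. 0 < \<rho> (Suc (Suc i))) \<and> \<rho> (Suc (Suc l)) = 0"
    using Suc.IH[of "\<rho> \<circ> Suc" "\<delta> \<circ> Suc"] Suc.prems by (simp add: numeral_2_eq_2 comp_def)
  moreover have "\<rho> 2 = \<delta> 0 * \<rho> 1 - \<rho> 0"
    using Suc.prems[of 0] by (simp add: numeral_2_eq_2)
  ultimately show ?case
    by (simp add: map_upt_Suc All_less_Suc2 comp_def conj_assoc del: upt_Suc)
qed

abbreviation (input) balanced :: "'a set \<Rightarrow> 'a set set \<Rightarrow> ('a \<Rightarrow> int) \<Rightarrow> ('a \<Rightarrow> int) \<Rightarrow> 'a \<Rightarrow> bool" where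
  "balanced V E d r u \<equiv> (\<Sum>v\<in>V. (diag_matrix d u v - adj_matrix E u v) * r v) = 0"

lemma balanced_iff:
  assumes "finite V" "u \<in> V"
  shows "balanced V E d r u \<longleftrightarrow> d u * r u = (\<Sum>v\<in>{v\<in>V. {u, v} \<in> E}. r v)"
proof -
  have "(\<Sum>v\<in>V. diag_matrix d u v * r v) = (\<Sum>v\<in>V. if u = v then d u * r u else 0)"
    by (intro sum.cong) (auto simp: diag_matrix_def)
  also have "\<dots> = d u * r u" using assms by simp
  finally have 1: "(\<Sum>v\<in>V. diag_matrix d u v * r v) = d u * r u" .
  have "(\<Sum>v\<in>V. adj_matrix E u v * r v) = (\<Sum>v\<in>V. if {u, v} \<in> E then r v else 0)"
    by (intro sum.cong) (auto simp: adj_matrix_def)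
  also have "\<dots> = (\<Sum>v\<in>{v\<in>V. {u, v} \<in> E}. r v)"
    using assms by (simp add: sum.inter_filter)
  finally show ?thesis using 1 by (simp add: left_diff_distrib sum_subtractf)
qed

text \<open>Padding by 0 beyond index l gives the end vertex the same recurrence as the inner ones
  and also covers l = 0, where the root has no neighbour on the path.\<close>

lemma bident_balanced_iff:
  fixes r :: "bident_vertex \<Rightarrow> int" and l :: nat
  defines "V \<equiv> bident_verts (l + 3)" and "E \<equiv> bident_edges (l + 3)"
    and "\<rho> \<equiv> \<lambda>i. if i \<le> l then r (Vpath i) else 0"
  shows "(\<forall>u\<in>V. balanced V E d r u) \<longleftrightarrow>
    d Vx * r Vx = \<rho> 0 \<and> d Vy * r Vy = \<rho> 0 \<and> d (Vpath 0) * \<rho> 0 = r Vx + r Vy + \<rho> 1 \<and>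
    (\<forall>i<l. d (Vpath (Suc i)) * \<rho> (Suc i) = \<rho> i + \<rho> (Suc (Suc i)))"
proof -
  have V: "V = {Vx, Vy} \<union> Vpath ` {0..l}" by (simp add: V_def bident_verts_def)
  have fin: "finite V" by (simp add: V)
  have x: "{v\<in>V. {Vx, v} \<in> E} = {Vpath 0}" and y: "{v\<in>V. {Vy, v} \<in> E} = {Vpath 0}"
    by (auto simp: V E_def bident_edges_def doubleton_eq_iff)
  have z: "{v\<in>V. {Vpath 0, v} \<in> E} = {Vx, Vy} \<union> (if 0 < l then {Vpath 1} else {})"
    by (auto simp: V E_def bident_edges_def doubleton_eq_iff)
  have p: "{v\<in>V. {Vpath (Suc i), v} \<in> E} = {Vpath i} \<union> (if Suc i < l then {Vpath (Suc (Suc i))} else {})"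
    if "i < l" for i
    using that by (auto simp: V E_def bident_edges_def doubleton_eq_iff)
  have "balanced V E d r Vx \<longleftrightarrow> d Vx * r Vx = \<rho> 0"
    by (subst balanced_iff[OF fin]) (simp_all only: x, simp_all add: V \<rho>_def)
  moreover have "balanced V E d r Vy \<longleftrightarrow> d Vy * r Vy = \<rho> 0"
    by (subst balanced_iff[OF fin]) (simp_all only: y, simp_all add: V \<rho>_def)
  moreover have "balanced V E d r (Vpath 0) \<longleftrightarrow> d (Vpath 0) * \<rho> 0 = r Vx + r Vy + \<rho> 1"
    by (subst balanced_iff[OF fin]) (simp_all only: z, auto simp add: V \<rho>_def)
  moreover have "balanced V E d r (Vpath (Suc i)) \<longleftrightarrow>
      d (Vpath (Suc i)) * \<rho> (Suc i) = \<rho> i + \<rho> (Suc (Suc i))" if "i < l" for i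
    using that by (subst balanced_iff[OF fin]) (simp_all only: p, auto simp add: V \<rho>_def)
  moreover have "(\<forall>u\<in>V. balanced V E d r u) \<longleftrightarrow> balanced V E d r Vx \<and> balanced V E d r Vy \<and>
      balanced V E d r (Vpath 0) \<and> (\<forall>i<l. balanced V E d r (Vpath (Suc i)))"
  proof -
    have "{0..l} = insert 0 (Suc ` {..<l})"
      by (simp add: atMost_atLeast0[symmetric] atMost_Suc_eq_insert_0 lessThan_Suc_atMost[symmetric] lessThan_Suc_eq_insert_0)
    then have "\<And>P. (\<forall>u\<in>V. P u) \<longleftrightarrow> P Vx \<and> P Vy \<and> P (Vpath 0) \<and> (\<forall>i<l. P (Vpath (Suc i)))"
      unfolding V by auto
    then show ?thesis .
  qed
  ultimately show ?thesis by auto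
qed

text \<open>Up to scaling, \<open>r\<^sub>0 = p q\<close>, \<open>r\<^sub>x = q\<close>, \<open>r\<^sub>y = p\<close> and hence \<open>r\<^sub>1 = D p q - (p + q)\<close>.\<close>

definition bident_data :: "nat \<Rightarrow> ((int \<times> int) \<times> int \<times> int list) set" where
  "bident_data l = Sigma ({1..} \<times> {1..}) (\<lambda>(p, q). rooted_chains l (p * q) (- (p + q)))"

definition read_data :: "nat \<Rightarrow> (bident_vertex \<Rightarrow> int) \<Rightarrow> (int \<times> int) \<times> int \<times> int list" where
  "read_data l d = ((d Vx, d Vy), d (Vpath 0), map (\<lambda>i. d (Vpath (Suc i))) [0..<l])"

text \<open>Since p r_x = q r_y = r_0, multiplying the root equation by p q gives p q r_1 = r_0 (D p
  q - (p + q)). Scaling the chain by p q and cancelling r_0 then avoids fractions.\<close>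

lemma read_data_mem:
  assumes "(d, r) \<in> Arith (bident_verts (l + 3)) (bident_edges (l + 3))"
  shows "read_data l d \<in> bident_data l"
proof -
  let ?V = "bident_verts (l + 3)"
  define \<rho> where "\<rho> = (\<lambda>i. if i \<le> l then r (Vpath i) else 0)"
  have V: "?V = {Vx, Vy} \<union> Vpath ` {0..l}" by (simp add: bident_verts_def)
  have d: "\<And>v. v \<in> ?V \<Longrightarrow> 0 < d v" and r: "\<And>v. v \<in> ?V \<Longrightarrow> 0 < r v"
    using assms by (auto simp: Arith_def PiE_iff)
  have eq: "d Vx * r Vx = \<rho> 0" "d Vy * r Vy = \<rho> 0" "d (Vpath 0) * \<rho> 0 = r Vx + r Vy + \<rho> 1"
    and rec: "\<And>i. i < l \<Longrightarrow> d (Vpath (Suc i)) * \<rho> (Suc i) = \<rho> i + \<rho> (Suc (Suc i))"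
    using assms bident_balanced_iff[of l d r] by (auto simp: Arith_def \<rho>_def)
  let ?ds = "map (\<lambda>i. d (Vpath (Suc i))) [0..<l]"
  let ?p = "d Vx" and ?q = "d Vy"
  have pos: "0 < ?p" "0 < ?q" "0 < \<rho> 0" using d r by (auto simp: V \<rho>_def)
  have "chain (\<rho> 0) (\<rho> 1) ?ds"
    by (subst chain_iff) (use rec r in \<open>auto simp: algebra_simps V \<rho>_def\<close>)
  then have "chain (?p * ?q * \<rho> 0) (?p * ?q * \<rho> 1) ?ds"
    using pos by (simp add: chain_scale)
  also have "?p * ?q * \<rho> 1 = \<rho> 0 * (d (Vpath 0) * (?p * ?q) - (?p + ?q))"
  proof -
    have "?p * ?q * \<rho> 1 = ?p * ?q * (d (Vpath 0) * \<rho> 0) - ?q * (?p * r Vx) - ?p * (?q * r Vy)"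
      using eq(3) by (simp add: algebra_simps)
    then show ?thesis by (simp add: eq algebra_simps)
  qed
  also have "?p * ?q * \<rho> 0 = \<rho> 0 * (?p * ?q)" by simp
  finally have "chain (?p * ?q) (d (Vpath 0) * (?p * ?q) - (?p + ?q)) ?ds"
    using pos(3) by (subst (asm) chain_scale)
  then show ?thesis
    using pos by (auto simp: bident_data_def read_data_def rooted_chains_def simp del: minus_add_distrib)
qed

text \<open>For equal d, both r and r' solve the same recurrence from the root outwards, so they are
  proportional; having gcd 1 forces the factor to be 1.\<close>

lemma read_data_inj:
  "inj_on (\<lambda>(d, r). read_data l d) (Arith (bident_verts (l + 3)) (bident_edges (l + 3)))"
proof -
  let ?V = "bident_verts (l + 3)" and ?E = "bident_edges (l + 3)"
  have V: "?V = {Vx, Vy} \<union> Vpath ` {0..l}" by (simp add: bident_verts_def)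
  have "d = d' \<and> r = r'"
    if A: "(d, r) \<in> Arith ?V ?E" and A': "(d', r') \<in> Arith ?V ?E" and eq: "read_data l d = read_data l d'"
    for d d' r r'
  proof
    have "d v = d' v" if "v \<in> ?V" for v
    proof -
      have "d (Vpath i) = d' (Vpath i)" if "i \<le> l" for i
        using that eq by (cases i) (auto simp: read_data_def)
      then show ?thesis using that eq by (auto simp: V read_data_def)
    qed
    then show d: "d = d'"
      using A A' by (intro PiE_ext[of d ?V "\<lambda>_. {0<..}" d']) (auto simp: Arith_def)
    define \<rho> \<rho>' where "\<rho> = (\<lambda>i. if i \<le> l then r (Vpath i) else 0)"
      and "\<rho>' = (\<lambda>i. if i \<le> l then r' (Vpath i) else 0)"
    have eqs: "d Vx * r Vx = \<rho> 0" "d Vy * r Vy = \<rho> 0" "d (Vpath 0) * \<rho> 0 = r Vx + r Vy + \<rho> 1"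
      and rec: "\<And>i. i < l \<Longrightarrow> d (Vpath (Suc i)) * \<rho> (Suc i) = \<rho> i + \<rho> (Suc (Suc i))"
      using A bident_balanced_iff[of l d r] by (auto simp: Arith_def \<rho>_def)
    have eqs': "d Vx * r' Vx = \<rho>' 0" "d Vy * r' Vy = \<rho>' 0" "d (Vpath 0) * \<rho>' 0 = r' Vx + r' Vy + \<rho>' 1"
      and rec': "\<And>i. i < l \<Longrightarrow> d (Vpath (Suc i)) * \<rho>' (Suc i) = \<rho>' i + \<rho>' (Suc (Suc i))"
      using A' bident_balanced_iff[of l d r'] d by (auto simp: Arith_def \<rho>'_def)
    have pos: "0 < d Vx" "0 < d Vy" "0 < \<rho> 0" "0 < \<rho>' 0"
      using A A' by (auto simp: Arith_def PiE_iff V \<rho>_def \<rho>'_def)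
    have "d Vx * (\<rho>' 0 * r Vx) = d Vx * (\<rho> 0 * r' Vx)" "d Vy * (\<rho>' 0 * r Vy) = d Vy * (\<rho> 0 * r' Vy)"
      by (metis eqs(1) eqs'(1) mult.left_commute mult.commute)
        (metis eqs(2) eqs'(2) mult.left_commute mult.commute)
    then have xy: "\<rho>' 0 * r Vx = \<rho> 0 * r' Vx" "\<rho>' 0 * r Vy = \<rho> 0 * r' Vy" using pos by auto
    have one: "\<rho>' 0 * \<rho> 1 = \<rho> 0 * \<rho>' 1"
    proof -
      have "\<rho>' 0 * \<rho> 1 = \<rho>' 0 * (d (Vpath 0) * \<rho> 0) - \<rho>' 0 * r Vx - \<rho>' 0 * r Vy"
        unfolding eqs(3) by (simp add: algebra_simps)
      also have "\<dots> = \<rho> 0 * (d (Vpath 0) * \<rho>' 0) - \<rho> 0 * r' Vx - \<rho> 0 * r' Vy"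
        by (simp add: xy)
      also have "\<dots> = \<rho> 0 * \<rho>' 1"
        unfolding eqs'(3) by (simp add: algebra_simps)
      finally show ?thesis .
    qed
    have "i \<le> l \<Longrightarrow> \<rho>' 0 * \<rho> i = \<rho> 0 * \<rho>' i \<and> \<rho>' 0 * \<rho> (Suc i) = \<rho> 0 * \<rho>' (Suc i)" for i
    proof (induction i)
      case 0
      then show ?case using one by simp
    next
      case (Suc i)
      have "\<rho>' 0 * \<rho> (Suc (Suc i)) = d (Vpath (Suc i)) * (\<rho>' 0 * \<rho> (Suc i)) - \<rho>' 0 * \<rho> i"
        using rec[of i] Suc.prems by (simp add: algebra_simps)
      also have "\<dots> = d (Vpath (Suc i)) * (\<rho> 0 * \<rho>' (Suc i)) - \<rho> 0 * \<rho>' i"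
        using Suc by simp
      also have "\<dots> = \<rho> 0 * \<rho>' (Suc (Suc i))"
        using rec'[of i] Suc.prems by (simp add: algebra_simps)
      finally show ?case using Suc by simp
    qed
    then have scaled: "\<rho>' 0 * r v = \<rho> 0 * r' v" if "v \<in> ?V" for v
      using that xy by (auto simp: V \<rho>_def \<rho>'_def)
    have "times (\<rho>' 0) ` (r ` ?V) = times (\<rho> 0) ` (r' ` ?V)"
      unfolding image_image using scaled by (rule image_cong[OF refl])
    then have "Gcd (times (\<rho>' 0) ` (r ` ?V)) = Gcd (times (\<rho> 0) ` (r' ` ?V))"
      by simp
    then have "\<rho>' 0 = \<rho> 0"
      using A A' pos by (simp add: Gcd_mult Arith_def)
    then have "r v = r' v" if "v \<in> ?V" for v
      using scaled[OF that] pos by simp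
    then show "r = r'"
      using A A' by (intro PiE_ext[of r ?V "\<lambda>_. {0<..}" r']) (auto simp: Arith_def)
  qed
  then show ?thesis by (auto simp: inj_on_def)
qed

text \<open>The chain is extended to an integral solution \<open>R\<close> with values q, p at the
  prongs and p q at the root; dividing by the gcd of its entries makes it primitive.\<close>

lemma read_data_surj:
  assumes "x \<in> bident_data l"
  shows "\<exists>d r. (d, r) \<in> Arith (bident_verts (l + 3)) (bident_edges (l + 3)) \<and> read_data l d = x"
proof -
  let ?V = "bident_verts (l + 3)" and ?E = "bident_edges (l + 3)"
  have V: "?V = {Vx, Vy} \<union> Vpath ` {0..l}" by (simp add: bident_verts_def)
  obtain p q D ds where x: "x = ((p, q), D, ds)" by (metis prod.exhaust)
  have pq: "0 < p" "0 < q" and len: "length ds = l" and ch: "chain (p * q) (D * (p * q) - (p + q)) ds"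
    using assms by (auto simp: x bident_data_def rooted_chains_def simp del: minus_add_distrib)
  define \<rho> where "\<rho> = cseq (p * q) (D * (p * q) - (p + q)) ds"
  have rec: "\<rho> (Suc (Suc i)) = ds ! i * \<rho> (Suc i) - \<rho> i" for i
    by (simp add: \<rho>_def)
  have \<rho>0: "\<rho> 0 = p * q" and \<rho>1: "\<rho> 1 = D * (p * q) - (p + q)" by (simp_all add: \<rho>_def)
  have "chain (\<rho> 0) (\<rho> 1) (map (\<lambda>i. ds ! i) [0..<l])"
    using ch len map_nth[of ds] by (simp add: \<rho>_def)
  then have path: "\<And>i. i < l \<Longrightarrow> 0 < \<rho> (Suc i)" "\<rho> (Suc l) = 0"
    using chain_iff[of l \<rho> "\<lambda>i. ds ! i"] rec by auto
  have pos: "0 < \<rho> i" if "i \<le> l" for i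
    using that path(1) pq by (cases i) (auto simp: \<rho>0)
  have nonneg: "0 \<le> \<rho> (Suc i)" if "i \<le> l" for i
    using that path by (cases "i = l") (auto simp: less_imp_le)
  \<comment> \<open>D p q equals r_1 + p + q, and r_1 is nonnegative (it is 0 when l = 0).\<close>
  have "0 < D * (p * q)"
    using nonneg[of 0] \<rho>1 pq by simp
  then have D: "0 < D" using pq by (metis mult_pos_pos zero_less_mult_pos2)
  have ds: "0 < ds ! i" if "i < l" for i
  proof -
    have "0 < ds ! i * \<rho> (Suc i)"
      using rec[of i] pos[of i] nonneg[of "Suc i"] that by simp
    then show ?thesis using path(1)[OF that] by (simp add: zero_less_mult_iff)
  qed
  define R where "R = (\<lambda>v. case v of Vx \<Rightarrow> q | Vy \<Rightarrow> p | Vpath i \<Rightarrow> \<rho> i)"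
  define g where "g = Gcd (R ` ?V)"
  define r where "r = restrict (\<lambda>v. R v div g) ?V"
  define d where "d = restrict (\<lambda>v. case v of Vx \<Rightarrow> p | Vy \<Rightarrow> q |
     Vpath i \<Rightarrow> (case i of 0 \<Rightarrow> D | Suc j \<Rightarrow> ds ! j)) ?V"
  have R: "0 < R v" if "v \<in> ?V" for v
    using that pq pos by (auto simp: R_def V)
  have "g \<noteq> 0" using R[of Vx] unfolding g_def by (auto simp: Gcd_0_iff V)
  then have g: "0 < g" unfolding g_def by (simp add: order_less_le)
  have Rr: "R v = g * r v" if "v \<in> ?V" for v
    using that by (simp add: r_def g_def Gcd_dvd)
  have r: "0 < r v" if "v \<in> ?V" for v
    using R[OF that] Rr[OF that] g by (simp add: zero_less_mult_iff)
  have "R ` ?V = times g ` (r ` ?V)"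
    unfolding image_image using Rr by (rule image_cong[OF refl])
  then have "g = Gcd (times g ` (r ` ?V))" by (simp only: g_def)
  also have "\<dots> = g * Gcd (r ` ?V)" using g by (simp add: Gcd_mult abs_mult)
  finally have "g = g * Gcd (r ` ?V)" .
  then have gcd: "Gcd (r ` ?V) = 1" using g by simp
  have d: "0 < d v" if "v \<in> ?V" for v
    using that pq D ds by (auto simp: d_def V split: nat.split)
  define \<rho>' where "\<rho>' = (\<lambda>i. if i \<le> l then r (Vpath i) else 0)"
  have \<rho>: "\<rho> i = g * \<rho>' i" if "i \<le> Suc l" for i
    using that path(2) Rr[of "Vpath i"] by (cases "i = Suc l") (auto simp: \<rho>'_def V R_def)
  have xy: "q = g * r Vx" "p = g * r Vy"
    using Rr[of Vx] Rr[of Vy] by (auto simp: V R_def)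
  have dv: "d Vx = p" "d Vy = q" "d (Vpath 0) = D" "\<And>i. i < l \<Longrightarrow> d (Vpath (Suc i)) = ds ! i"
    by (auto simp: d_def V)
  have "d Vx * r Vx = \<rho>' 0 \<and> d Vy * r Vy = \<rho>' 0 \<and> d (Vpath 0) * \<rho>' 0 = r Vx + r Vy + \<rho>' 1 \<and>
    (\<forall>i<l. d (Vpath (Suc i)) * \<rho>' (Suc i) = \<rho>' i + \<rho>' (Suc (Suc i)))"
  proof (intro conjI allI impI)
    have "g * (d Vx * r Vx) = p * (g * r Vx)" "g * (d Vy * r Vy) = (g * r Vy) * q"
      by (simp_all add: dv)
    then have "g * (d Vx * r Vx) = g * \<rho>' 0" "g * (d Vy * r Vy) = g * \<rho>' 0"
      unfolding xy[symmetric] using \<rho>[of 0] \<rho>0 by simp_all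
    then show "d Vx * r Vx = \<rho>' 0" "d Vy * r Vy = \<rho>' 0" using g by auto
    have "g * (d (Vpath 0) * \<rho>' 0) = D * \<rho> 0"
      using \<rho>[of 0] by (simp add: dv)
    also have "\<dots> = q + p + \<rho> 1" using \<rho>0 \<rho>1 by simp
    also have "\<dots> = g * (r Vx + r Vy + \<rho>' 1)"
      using \<rho>[of 1] xy by (simp add: distrib_left)
    finally show "d (Vpath 0) * \<rho>' 0 = r Vx + r Vy + \<rho>' 1" using g by simp
    fix i assume i: "i < l"
    have "g * (d (Vpath (Suc i)) * \<rho>' (Suc i)) = ds ! i * \<rho> (Suc i)"
      using \<rho>[of "Suc i"] i by (simp add: dv)
    also have "\<dots> = \<rho> i + \<rho> (Suc (Suc i))" using rec[of i] by simp
    also have "\<dots> = g * (\<rho>' i + \<rho>' (Suc (Suc i)))"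
      using \<rho>[of i] \<rho>[of "Suc (Suc i)"] i by (simp add: distrib_left)
    finally show "d (Vpath (Suc i)) * \<rho>' (Suc i) = \<rho>' i + \<rho>' (Suc (Suc i))" using g by simp
  qed
  then have "\<forall>u\<in>?V. balanced ?V ?E d r u"
    unfolding bident_balanced_iff \<rho>'_def .
  then have "(d, r) \<in> Arith ?V ?E"
    using d r gcd by (auto simp: Arith_def PiE_iff r_def d_def)
  moreover have "read_data l d = x"
    using dv len by (auto simp: read_data_def x intro!: nth_equalityI)
  ultimately show ?thesis by blast
qed

lemma card_Arith_bident:
  "card (Arith (bident_verts (l + 3)) (bident_edges (l + 3))) = card (bident_data l)"
proof -
  have "(\<lambda>(d, r). read_data l d) ` Arith (bident_verts (l + 3)) (bident_edges (l + 3)) = bident_data l"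
  proof (intro equalityI subsetI)
    fix x assume "x \<in> bident_data l"
    then obtain d r where "(d, r) \<in> Arith (bident_verts (l + 3)) (bident_edges (l + 3))" "x = read_data l d"
      using read_data_surj by metis
    then show "x \<in> (\<lambda>(d, r). read_data l d) ` Arith (bident_verts (l + 3)) (bident_edges (l + 3))"
      by (intro image_eqI[of _ _ "(d, r)"]) auto
  qed (use read_data_mem in auto)
  then show ?thesis using card_image[OF read_data_inj[of l]] by simp
qed

subsection \<open>Counting the pairs of prongs\<close>

text \<open>Division with remainder, b = (b div a) a + b mod a, puts b into the form required by
  \<open>hj_length_shift\<close>.\<close>

lemma hj_length_dual:
  assumes "0 < a" "a \<le> b"
  shows "int (hj_length b (- a)) + 1 = int (hj_length a b) + b div a"
proof -
  have "1 \<le> b div a" using assms by (simp add: pos_imp_zdiv_pos_iff int_one_le_iff_zero_less)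
  then have k: "int (Suc (nat (b div a) - 1)) = b div a" by simp
  have "hj_length b (- a) = hj_length (int (Suc (nat (b div a) - 1)) * a + b mod a) (- a)"
    unfolding k by simp
  also have "\<dots> = hj_length a (b mod a) + (nat (b div a) - 1)"
    using assms by (intro hj_length_shift) auto
  also have "hj_length a (b mod a) = hj_length a b"
    by (rule hj_length_mod_cong) simp
  finally show ?thesis using k by simp
qed

text \<open>By \<open>hj_length_dual\<close> the length plus 1 is at least b/a rounded up: if a does
  not divide b, the positive \<open>hj_length a b\<close> makes up for the rounding in
  \<open>b div a\<close>.\<close>

lemma hj_length_lower:
  assumes "0 < a" "a \<le> b"
  shows "b \<le> a * (int (hj_length b (- a)) + 1)"
proof (cases "a dvd b")
  case True
  then have "b = a * (b div a)" by simp
  also have "\<dots> \<le> a * (int (hj_length b (- a)) + 1)"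
    using hj_length_dual[OF assms] assms by (intro mult_left_mono) auto
  finally show ?thesis .
next
  case False
  have "b \<le> a * (b div a + 1)"
    using assms by (metis add.commute distrib_left mult.right_neutral mult_div_mod_eq pos_mod_bound less_imp_le add_le_cancel_left add.commute)
  also have "\<dots> \<le> a * (int (hj_length b (- a)) + 1)"
    using hj_length_dual[OF assms] hj_length_pos[OF assms(1) False] assms
    by (intro mult_left_mono) auto
  finally show ?thesis .
qed

definition prong_length :: "int \<Rightarrow> int \<Rightarrow> nat" where
  "prong_length p q = hj_length (p * q) (- (p + q))"

lemma prong_length_commute: "prong_length p q = prong_length q p"
  by (simp add: prong_length_def mult.commute add.commute)

text \<open>Modulo q the second argument is -1, and q/(q - 1) expands into q - 1 twos.\<close>

lemma prong_length_1: "1 \<le> q \<Longrightarrow> prong_length 1 q = nat (q - 1)"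
proof -
  assume q: "1 \<le> q"
  have "prong_length 1 q = hj_length q (- 1)"
    using hj_length_minus_add[of q 1] by (simp add: prong_length_def add.commute)
  also have "\<dots> = hj_length (int (Suc (nat (q - 1))) * 1 + 0) (- 1)"
    using q by simp
  also have "\<dots> = hj_length 1 0 + nat (q - 1)"
    by (rule hj_length_shift) auto
  also have "hj_length 1 0 = 0" by (simp add: hj_length.simps)
  finally show ?thesis by simp
qed

lemma prong_length_2_2: "prong_length 2 2 = 0"
  and prong_length_2_3: "prong_length 2 3 = 1"
  by (simp_all add: prong_length_def hj_length.simps)

section \<open>Lower bounds for the length when both prong entries are at least 2\<close>

lemma sum_le_prod:
  fixes p q :: int
  assumes "2 \<le> p" "2 \<le> q"
  shows "p + q \<le> p * q"
proof -
  have "1 * 1 \<le> (p - 1) * (q - 1)" using assms by (intro mult_mono) auto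
  then show ?thesis by (simp add: algebra_simps)
qed

text \<open>Equivalently 1/p + 1/q >= 1/(m + 1). This leaves q unbounded when p <= m + 1, a range
  that needs the next lemma.\<close>

lemma prong_length_lower:
  assumes "2 \<le> p" "2 \<le> q"
  shows "p * q \<le> (p + q) * (int (prong_length p q) + 1)"
  using assms sum_le_prod[OF assms] unfolding prong_length_def
  by (intro hj_length_lower) auto

text \<open>Here \<open>p q \<equiv> - p\<^sup>2\<close> modulo \<open>p + q\<close>, so the reduction step \<open>hj_length_dual\<close> can be used a second
  time, with \<open>p\<^sup>2\<close> and \<open>p + q\<close>.\<close>

lemma prong_length_lower_long:
  assumes "2 \<le> p" "2 \<le> q" "p\<^sup>2 \<le> p + q"
  shows "p + q \<le> p\<^sup>2 * (int (prong_length p q) + 3 - p)"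
proof -
  have "p * q div (p + q) = p - 1"
  proof (rule int_div_pos_eq)
    show "p * q = (p + q) * (p - 1) + (p + q - p\<^sup>2)"
      by (simp add: algebra_simps power2_eq_square)
  qed (use assms in auto)
  moreover have "p * q - - p\<^sup>2 = (p + q) * p"
    by (simp add: algebra_simps power2_eq_square)
  then have "hj_length (p + q) (p * q) = hj_length (p + q) (- p\<^sup>2)"
    by (intro hj_length_mod_cong) (simp only: mod_eq_dvd_iff dvd_triv_left)
  ultimately have "int (prong_length p q) + 1 = int (hj_length (p + q) (- p\<^sup>2)) + (p - 1)"
    using hj_length_dual[of "p + q" "p * q"] assms sum_le_prod[of p q]
    by (simp add: prong_length_def)
  then have e: "int (hj_length (p + q) (- p\<^sup>2)) + 1 = int (prong_length p q) + 3 - p" by simp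
  have "p + q \<le> p\<^sup>2 * (int (hj_length (p + q) (- p\<^sup>2)) + 1)"
    using assms by (intro hj_length_lower) auto
  then show ?thesis unfolding e .
qed

section \<open>A quartic bound for the number of pairs\<close>

definition prong_pairs :: "nat \<Rightarrow> (int \<times> int) set" where
  "prong_pairs m = {(p, q). 2 \<le> p \<and> 2 \<le> q \<and> prong_length p q \<le> m}"

text \<open>Meant to cover the pairs with p <= q only; the others are obtained by swapping. Here s
  stands for m + 1.\<close>

definition prong_box :: "int \<Rightarrow> (int \<times> int) set" where
  "prong_box s = Sigma {1..s} (\<lambda>p. {1..p\<^sup>2 * (s + 2 - p)}) \<union> {s<..2 * s} \<times> {s<..s + s\<^sup>2}"

text \<open>For p <= s, q is bounded by \<open>prong_length_lower_long\<close>, or directly if p^2 >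
  p + q. For p > s, \<open>prong_length_lower\<close> becomes (p - s)(q - s) <= s^2, which bounds q
  - s by s^2 and, as p <= q, p - s by s.\<close>

lemma prong_pairs_in_box:
  assumes "(p, q) \<in> prong_pairs m" "p \<le> q"
  shows "(p, q) \<in> prong_box (int m + 1)"
proof -
  define s where "s = int m + 1"
  have pq: "2 \<le> p" "2 \<le> q" and m: "int (prong_length p q) + 1 \<le> s"
    using assms by (auto simp: prong_pairs_def s_def)
  show ?thesis
  proof (cases "p \<le> s")
    case True
    have "q \<le> p\<^sup>2 * (s + 2 - p)"
    proof (cases "p\<^sup>2 \<le> p + q")
      case long: True
      have "p + q \<le> p\<^sup>2 * (int (prong_length p q) + 3 - p)"
        using prong_length_lower_long pq long by blast
      also have "\<dots> \<le> p\<^sup>2 * (s + 2 - p)"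
        using m by (intro mult_left_mono) auto
      finally show ?thesis using pq by simp
    next
      case False
      then have "q \<le> p\<^sup>2 * 1" using pq by simp
      also have "\<dots> \<le> p\<^sup>2 * (s + 2 - p)"
        using True by (intro mult_left_mono) auto
      finally show ?thesis .
    qed
    then show ?thesis using True pq by (simp add: prong_box_def s_def[symmetric])
  next
    case False
    have "p * q \<le> (p + q) * (int (prong_length p q) + 1)"
      using prong_length_lower pq by blast
    also have "\<dots> \<le> (p + q) * s"
      using m pq by (intro mult_left_mono) auto
    finally have *: "(p - s) * (q - s) \<le> s\<^sup>2"
      by (simp add: algebra_simps power2_eq_square)
    have "1 * (q - s) \<le> (p - s) * (q - s)"
      using False assms by (intro mult_right_mono) auto
    then have 1: "q \<le> s + s\<^sup>2" using * by simp
    have "(p - s)\<^sup>2 \<le> (p - s) * (q - s)"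
      using False assms unfolding power2_eq_square by (intro mult_left_mono) auto
    then have "(p - s)\<^sup>2 \<le> s\<^sup>2" using * by simp
    then have "p - s \<le> s"
      by (rule power2_le_imp_le) (simp add: s_def)
    then show ?thesis using 1 False assms by (simp add: prong_box_def s_def[symmetric])
  qed
qed

lemma sum_square_times_linear:
  "(\<Sum>i=1..k. (real i)\<^sup>2 * (N - real i)) =
     N * (real k * (real k + 1) * (2 * real k + 1)) / 6 - (real k * (real k + 1))\<^sup>2 / 4"
  by (induction k) (simp_all add: field_simps power2_eq_square)

text \<open>With s = m + 1, the first term is twice the sum of i^2 (s + 2 - i) over i = 1, ..., s,
  and the second is twice the size s^3 of the rectangle; the factor 2 accounts for swapping.\<close>

definition prong_bound :: "nat \<Rightarrow> real" where
  "prong_bound m = (real m + 1) * (real m + 2) * ((real m + 1)\<^sup>2 + 7 * (real m + 1) + 4) / 6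
     + 2 * (real m + 1) ^ 3"

lemma finite_prong_box: "finite (prong_box s)"
  by (simp add: prong_box_def)

lemma card_prong_box: "2 * real (card (prong_box (int m + 1))) \<le> prong_bound m"
proof -
  let ?s = "int m + 1"
  have "card (Sigma {1..?s} (\<lambda>p. {1..p\<^sup>2 * (?s + 2 - p)})) = (\<Sum>p=1..?s. nat (p\<^sup>2 * (?s + 2 - p)))"
    by (subst card_SigmaI) auto
  also have "real \<dots> = (\<Sum>p=1..?s. real_of_int (p\<^sup>2 * (?s + 2 - p)))"
    unfolding of_nat_sum by (intro sum.cong refl of_nat_nat) auto
  also have "\<dots> = (\<Sum>i=1..Suc m. (real i)\<^sup>2 * (real m + 3 - real i))"
    by (rule sum.reindex_bij_witness[of _ int nat]) auto
  finally have 1: "real (card (Sigma {1..?s} (\<lambda>p. {1..p\<^sup>2 * (?s + 2 - p)}))) = \<dots>" .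
  have "nat (?s + ?s\<^sup>2 - ?s) = (Suc m)\<^sup>2"
    by (simp add: nat_power_eq nat_add_distrib)
  then have 2: "card ({?s<..2 * ?s} \<times> {?s<..?s + ?s\<^sup>2}) = Suc m * (Suc m)\<^sup>2"
    by (simp add: card_cartesian_product nat_add_distrib)
  have "real (card (prong_box ?s)) \<le>
      real (card (Sigma {1..?s} (\<lambda>p. {1..p\<^sup>2 * (?s + 2 - p)})) + Suc m * (Suc m)\<^sup>2)"
    unfolding prong_box_def 2[symmetric] of_nat_le_iff by (rule card_Un_le)
  also have "\<dots> = (\<Sum>i=1..Suc m. (real i)\<^sup>2 * (real m + 3 - real i)) + (real m + 1) ^ 3"
    unfolding of_nat_add 1 of_nat_mult of_nat_power of_nat_Suc by (simp add: power2_eq_square power3_eq_cube add_ac)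
  also have "\<dots> = prong_bound m / 2"
    unfolding sum_square_times_linear by (simp add: prong_bound_def field_simps power2_eq_square power3_eq_cube)
  finally show ?thesis by simp
qed

lemma card_prong_pairs:
  "finite (prong_pairs m)" "real (card (prong_pairs m)) \<le> prong_bound m"
proof -
  let ?B = "prong_box (int m + 1)"
  have sub: "prong_pairs m \<subseteq> ?B \<union> prod.swap ` ?B"
  proof clarify
    fix p q assume pq: "(p, q) \<in> prong_pairs m" and "(p, q) \<notin> prod.swap ` ?B"
    then have "(q, p) \<notin> ?B" by force
    moreover have "(q, p) \<in> prong_pairs m" using pq by (auto simp: prong_pairs_def prong_length_commute)
    ultimately have "p \<le> q" using prong_pairs_in_box[of q p m] by force
    then show "(p, q) \<in> ?B" using prong_pairs_in_box pq by blast
  qed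
  show "finite (prong_pairs m)"
    using sub finite_prong_box by (meson finite_UnI finite_imageI finite_subset)
  have "card (prong_pairs m) \<le> card (?B \<union> prod.swap ` ?B)"
    using sub finite_prong_box by (intro card_mono) auto
  also have "\<dots> \<le> card ?B + card (prod.swap ` ?B)" by (rule card_Un_le)
  also have "\<dots> = 2 * card ?B" by (simp add: card_image)
  finally have "real (card (prong_pairs m)) \<le> 2 * real (card ?B)" by linarith
  then show "real (card (prong_pairs m)) \<le> prong_bound m" using card_prong_box[of m] by simp
qed

text \<open>Consecutive weights differ by (m + 1)/2^m - (m + 2)/2^(m+1) = m/2^(m+1). This is the
  summation by parts that trades pairs of length exactly m for pairs of length at most m.\<close>

lemma weight_telescope:
  assumes "j \<le> K"
  shows "(real j + 1) / 2 ^ j = (\<Sum>m=j..K. real m / 2 ^ Suc m) + (real K + 2) / 2 ^ Suc K"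
  using assms
proof (induction K rule: dec_induct)
  case base
  show ?case by (simp add: field_simps)
next
  case (step K)
  have "(real K + 2) / 2 ^ Suc K = real (Suc K) / 2 ^ Suc (Suc K) + (real (Suc K) + 2) / 2 ^ Suc (Suc K)"
    by (simp add: field_simps)
  then show ?case using step by simp
qed

text \<open>The polynomial is the one for which the partial sums below telescope.\<close>

definition prong_tail :: "nat \<Rightarrow> real" where
  "prong_tail K = (7296 + 5028 * real K + 1676 * real K ^ 2 + 329 * real K ^ 3 + 34 * real K ^ 4 + real K ^ 5) / 6"

text \<open>The constant 608 is \<open>prong_tail 0 / 2\<close>, because the summand at m = 0
  vanishes; it is also the value of the infinite series.\<close>

lemma prong_bound_sum:
  "(\<Sum>m\<le>K. prong_bound m * (real m / 2 ^ Suc m)) = 608 - prong_tail K / 2 ^ Suc K"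
proof (induction K)
  case 0
  show ?case by (simp add: prong_tail_def)
next
  case (Suc K)
  have "prong_tail (Suc K) = 2 * prong_tail K - prong_bound (Suc K) * real (Suc K)"
    unfolding prong_tail_def prong_bound_def of_nat_Suc
    by (simp add: field_simps) (simp add: algebra_simps eval_nat_numeral)
  then have "prong_tail (Suc K) / 2 ^ Suc (Suc K) =
      prong_tail K / 2 ^ Suc K - prong_bound (Suc K) * (real (Suc K) / 2 ^ Suc (Suc K))"
    by (simp add: diff_divide_distrib)
  then show ?case
    unfolding sum.atMost_Suc Suc by simp
qed

text \<open>The boundary term of the summation by parts is absorbed by the remaining tail: the
  difference of the two numerators has nonnegative coefficients.\<close>

lemma prong_bound_total:
  "(\<Sum>m\<le>K. prong_bound m * (real m / 2 ^ Suc m)) + prong_bound K * ((real K + 2) / 2 ^ Suc K) \<le> 608"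
proof -
  have "prong_tail K - prong_bound K * (real K + 2) =
      (7224 + 4812 * real K + 1432 * real K ^ 2 + 204 * real K ^ 3 + 8 * real K ^ 4) / 6"
    unfolding prong_tail_def prong_bound_def
    by (simp add: field_simps) (simp add: algebra_simps eval_nat_numeral)
  also have "\<dots> \<ge> 0" by simp
  finally have "prong_bound K * (real K + 2) / 2 ^ Suc K \<le> prong_tail K / 2 ^ Suc K"
    by (intro divide_right_mono) auto
  then show ?thesis unfolding prong_bound_sum by simp
qed

lemma sum_prong_pairs_le:
  "(\<Sum>(p, q)\<in>prong_pairs l. real (ballot l (prong_length p q))) \<le> 608 * catalan l"
proof -
  let ?Y = "prong_pairs l" and ?L = "\<lambda>(p, q). prong_length p q"
  have fin: "finite ?Y" by (rule card_prong_pairs)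
  have sub: "{x \<in> ?Y. ?L x \<le> m} = prong_pairs m" if "m \<le> l" for m
    using that by (auto simp: prong_pairs_def)
  have C: "0 \<le> catalan l" by (simp add: catalan_def)
  \<comment> \<open>Expanding every weight up to K = l and exchanging the sums leaves the
    cardinalities of \<open>prong_pairs m\<close>.\<close>
  have "(\<Sum>x\<in>?Y. (real (?L x) + 1) / 2 ^ ?L x) =
        (\<Sum>x\<in>?Y. (\<Sum>m\<in>{..l}. if ?L x \<le> m then real m / 2 ^ Suc m else 0) + (real l + 2) / 2 ^ Suc l)"
  proof (intro sum.cong refl)
    fix x assume "x \<in> ?Y"
    then have "?L x \<le> l" by (auto simp: prong_pairs_def)
    moreover have "{m \<in> {..l}. ?L x \<le> m} = {?L x..l}" by auto
    ultimately show "(real (?L x) + 1) / 2 ^ ?L x =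
        (\<Sum>m\<in>{..l}. if ?L x \<le> m then real m / 2 ^ Suc m else 0) + (real l + 2) / 2 ^ Suc l"
      by (subst sum.inter_filter[symmetric]) (simp_all only: weight_telescope finite_atMost)
  qed
  also have "\<dots> = (\<Sum>m\<le>l. \<Sum>x\<in>?Y. if ?L x \<le> m then real m / 2 ^ Suc m else 0)
      + real (card ?Y) * ((real l + 2) / 2 ^ Suc l)"
    by (subst sum.swap) (simp add: sum.distrib)
  also have "(\<Sum>m\<le>l. \<Sum>x\<in>?Y. if ?L x \<le> m then real m / 2 ^ Suc m else 0) =
      (\<Sum>m\<le>l. real (card (prong_pairs m)) * (real m / 2 ^ Suc m))"
  proof (intro sum.cong refl)
    fix m assume "m \<in> {..l}"
    then show "(\<Sum>x\<in>?Y. if ?L x \<le> m then real m / 2 ^ Suc m else 0) =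
        real (card (prong_pairs m)) * (real m / 2 ^ Suc m)"
      by (subst sum.inter_filter[symmetric, OF fin]) (simp add: sub)
  qed
  also have "\<dots> + real (card ?Y) * ((real l + 2) / 2 ^ Suc l) \<le>
      (\<Sum>m\<le>l. prong_bound m * (real m / 2 ^ Suc m)) + prong_bound l * ((real l + 2) / 2 ^ Suc l)"
    by (intro add_mono sum_mono mult_right_mono card_prong_pairs) auto
  also have "\<dots> \<le> 608" by (rule prong_bound_total)
  finally have "(\<Sum>x\<in>?Y. (real (?L x) + 1) / 2 ^ ?L x) \<le> 608" .
  then have "catalan l * (\<Sum>x\<in>?Y. (real (?L x) + 1) / 2 ^ ?L x) \<le> catalan l * 608"
    using C by (rule mult_left_mono)
  moreover have "(\<Sum>x\<in>?Y. real (ballot l (?L x))) \<le> catalan l * (\<Sum>x\<in>?Y. (real (?L x) + 1) / 2 ^ ?L x)"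
    unfolding sum_distrib_left by (intro sum_mono ballot_le_catalan)
  ultimately show ?thesis by (simp add: case_prod_unfold)
qed

text \<open>Fibres over pairs of prong length above l are empty, so the finite set \<open>X\<close>
  suffices. Pairs with p = 1 have lengths 0, ..., l and sum to C(l + 1); those with q = 1 and p >= 2
  have lengths 1, ..., l and thus miss \<open>ballot l 0\<close> = C(l).\<close>

lemma card_bident_data:
  "real (card (bident_data l)) = 2 * catalan (Suc l) - catalan l
     + (\<Sum>(p, q)\<in>prong_pairs l. real (ballot l (prong_length p q)))"
proof -
  let ?L = "\<lambda>(p, q). prong_length p q"
  define X where "X = {(p, q). 1 \<le> p \<and> 1 \<le> q \<and> prong_length p q \<le> l}"
  define X1 X2 where "X1 = Pair (1::int) ` {1..int l + 1}" and "X2 = (\<lambda>p. (p, 1::int)) ` {2..int l + 1}"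
  have X: "X = X1 \<union> X2 \<union> prong_pairs l"
  proof (intro equalityI subsetI)
    fix x assume x: "x \<in> X"
    obtain p q where pq: "x = (p, q)" by (cases x)
    consider "p = 1" | "q = 1" "2 \<le> p" | "2 \<le> p" "2 \<le> q"
      using x pq by (fastforce simp: X_def)
    then show "x \<in> X1 \<union> X2 \<union> prong_pairs l"
      using x unfolding pq
      by cases (auto simp: X_def X1_def X2_def prong_pairs_def prong_length_1 prong_length_commute[of _ 1])
  next
    fix x assume "x \<in> X1 \<union> X2 \<union> prong_pairs l"
    then show "x \<in> X"
      by (auto simp: X_def X1_def X2_def prong_pairs_def prong_length_1 prong_length_commute[of _ 1])
  qed
  have fin: "finite X1" "finite X2" "finite (prong_pairs l)" "finite X"
    using card_prong_pairs(1) by (auto simp: X X1_def X2_def)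
  have X_pos: "X \<subseteq> {1..} \<times> {1..}" by (auto simp: X_def)
  have fib: "finite (case x of (p, q) \<Rightarrow> rooted_chains l (p * q) (- (p + q)))"
    "card (case x of (p, q) \<Rightarrow> rooted_chains l (p * q) (- (p + q))) = ballot l (?L x)"
    if "x \<in> {1..} \<times> {1..}" for x
  proof -
    obtain p q where x: "x = (p, q)" by (cases x)
    then have "0 < p * q" using that by auto
    with x show "finite (case x of (p, q) \<Rightarrow> rooted_chains l (p * q) (- (p + q)))"
      "card (case x of (p, q) \<Rightarrow> rooted_chains l (p * q) (- (p + q))) = ballot l (?L x)"
      using card_rooted_chains[of "p * q" l "- (p + q)"] by (simp_all add: prong_length_def)
  qed
  have "bident_data l = Sigma X (\<lambda>(p, q). rooted_chains l (p * q) (- (p + q)))"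
  proof (intro equalityI subsetI)
    fix y assume y: "y \<in> bident_data l"
    obtain x z where yz: "y = (x, z)" by (cases y)
    have x: "x \<in> {1..} \<times> {1..}" and z: "z \<in> (case x of (p, q) \<Rightarrow> rooted_chains l (p * q) (- (p + q)))"
      using y yz by (auto simp: bident_data_def)
    have "card (case x of (p, q) \<Rightarrow> rooted_chains l (p * q) (- (p + q))) \<noteq> 0"
      using fib(1)[OF x] z by (metis card_0_eq empty_iff)
    then have "\<not> l < ?L x" unfolding fib(2)[OF x] by (metis ballot_eq_0)
    then have "?L x \<le> l" by simp
    then have "x \<in> X" using x by (auto simp: X_def)
    then show "y \<in> Sigma X (\<lambda>(p, q). rooted_chains l (p * q) (- (p + q)))"
      using z yz by auto
  qed (auto simp: bident_data_def X_def)
  then have "card (bident_data l) = card (Sigma X (\<lambda>(p, q). rooted_chains l (p * q) (- (p + q))))"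
    by (simp only:)
  also have "card (Sigma X (\<lambda>(p, q). rooted_chains l (p * q) (- (p + q)))) = (\<Sum>x\<in>X. card (case x of (p, q) \<Rightarrow> rooted_chains l (p * q) (- (p + q))))"
    using fin(4) fib(1) X_pos by (intro card_SigmaI) blast+
  also have "\<dots> = (\<Sum>x\<in>X. ballot l (?L x))"
    using fib(2) X_pos by (intro sum.cong refl) blast
  also have "\<dots> = (\<Sum>x\<in>X1. ballot l (?L x)) + (\<Sum>x\<in>X2. ballot l (?L x)) + (\<Sum>x\<in>prong_pairs l. ballot l (?L x))"
    unfolding X using fin
    by (subst sum.union_disjoint; (subst sum.union_disjoint)?)
      (auto simp: X1_def X2_def prong_pairs_def)
  also have "(\<Sum>x\<in>X1. ballot l (?L x)) = (\<Sum>j=0..l. ballot l j)"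
    by (rule sum.reindex_bij_witness[of _ "\<lambda>j. (1, int j + 1)" "\<lambda>(p, q). nat (q - 1)"])
      (auto simp: X1_def prong_length_1)
  also have "(\<Sum>x\<in>X2. ballot l (?L x)) = (\<Sum>j=1..l. ballot l j)"
    by (rule sum.reindex_bij_witness[of _ "\<lambda>j. (int j + 1, 1)" "\<lambda>(p, q). nat (p - 1)"])
      (auto simp: X2_def prong_length_1 prong_length_commute[of _ 1])
  also have "(\<Sum>j=0..l. ballot l j) = ballot (Suc l) 0" by simp
  finally have "real (card (bident_data l)) = real (ballot (Suc l) 0) + real (\<Sum>j=1..l. ballot l j)
      + (\<Sum>x\<in>prong_pairs l. real (ballot l (?L x)))"
    by (simp del: ballot.simps)
  moreover have "ballot (Suc l) 0 = ballot l 0 + (\<Sum>j=1..l. ballot l j)"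
    by (simp add: sum.atLeast_Suc_atMost)
  ultimately show ?thesis
    by (simp add: ballot_0_catalan[symmetric] case_prod_unfold del: ballot.simps)
qed

text \<open>The pair (2, 3) has length 1, so it contributes a full Catalan number only on a path of
  positive length; this is where n >= 4 enters.\<close>

lemma sum_prong_pairs_ge:
  "2 * catalan (Suc l) \<le> (\<Sum>(p, q)\<in>prong_pairs (Suc l). real (ballot (Suc l) (prong_length p q)))"
proof -
  have "2 * catalan (Suc l) = (\<Sum>(p, q)\<in>{(2, 2), (2, 3)}. real (ballot (Suc l) (prong_length p q)))"
    using ballot_Suc_0_eq_1[of l]
    by (simp add: prong_length_2_2 prong_length_2_3 ballot_0_catalan[symmetric] del: ballot.simps)
  also have "\<dots> \<le> (\<Sum>(p, q)\<in>prong_pairs (Suc l). real (ballot (Suc l) (prong_length p q)))"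
    using card_prong_pairs(1)
    by (intro sum_mono2) (auto simp: prong_pairs_def prong_length_2_2 prong_length_2_3 simp del: ballot.simps)
  finally show ?thesis .
qed

theorem theorem4p9:
  fixes n :: nat
  assumes "n \<ge> 4"
  shows "2 * catalan (n - 2) + catalan (n - 3)
           \<le> real (card (Arith (bident_verts n) (bident_edges n)))
       \<and> real (card (Arith (bident_verts n) (bident_edges n)))
           < 2 * catalan (n - 2) + 702 * catalan (n - 3)"
proof -
  obtain k where k: "n = Suc k + 3" using assms that[of "n - 4"] by simp
  have l: "n - 3 = Suc k" "n - 2 = Suc (Suc k)" by (auto simp: k)
  \<comment> \<open>Positivity yields the strict inequality: the coefficient actually reached is 608
    - 1 = 607.\<close>
  have "0 < catalan (Suc k)" by (simp add: catalan_def del: binomial_Suc_Suc)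
  then show ?thesis
    using card_bident_data[of "Suc k"] sum_prong_pairs_ge[of k] sum_prong_pairs_le[of "Suc k"]
    unfolding l unfolding k card_Arith_bident by linarith
qed

end
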